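(* Let $k\ge 0$ be a fixed integer and let $t_k(n)$ be the total number of $k$-protected vertices in all unlabeled rooted plane trees on $n$ vertices. Then, as $n\to\infty$, $$t_k(n)\sim \frac{3\binom{2n-2}{n-1}}{4^k+2}.$$
   Context: A tree means an unlabeled rooted plane tree (a finite rooted tree with at least one vertex in which the children of every vertex are linearly ordered), counted up to isomorphism; its size is its number of vertices. A leaf is a vertex with no children (so the root of the one-vertex tree is a leaf). A vertex is $k$-protected if at least $k$ downward steps (parent to child) are needed to reach any leaf from it, i.e. every descending path from the vertex to a leaf has length at least $k$. $t_k(n)$ counts pairs (tree on $n$ vertices, $k$-protected vertex of it). Write $a_n\sim b_n$ if $\lim_{n\to\infty} a_n/b_n=1$. *)

theory Defs
  imports Complex_Main "HOL-Library.Landau_Symbols"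
begin

text \<open>
  An unlabeled rooted plane tree is given by the ordered list of the subtrees hanging from the
  children of its root; every isomorphism class is represented by exactly one value of this type.
\<close>

datatype plane_tree = Node (subtrees: "plane_tree list")

text \<open>
  A vertex is identified with its address: the list of child indices leading to it from the
  root, whose own address is the empty list.
\<close>

function vertices :: "plane_tree \<Rightarrow> nat list set" where
  "vertices (Node ts) = insert [] (\<Union>i\<in>{..<length ts}. (\<lambda>p. i # p) ` vertices (ts ! i))"
  by pat_completeness auto
termination
  by (relation "measure size")
     (auto simp: less_Suc_eq_le intro!: size_list_estimation'[where f = size, OF nth_mem])

definition child_rel :: "plane_tree \<Rightarrow> (nat list \<times> nat list) set" where
  "child_rel t = {(p, q). p \<in> vertices t \<and> q \<in> vertices t \<and> (\<exists>i. q = p @ [i])}"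

definition leaf :: "plane_tree \<Rightarrow> nat list \<Rightarrow> bool" where
  "leaf t p \<longleftrightarrow> p \<in> vertices t \<and> (\<nexists>q. (p, q) \<in> child_rel t)"

text \<open>
  Membership of \<open>(p, q)\<close> in the relational power \<open>child_rel t ^^ m\<close> says that there is a descending
  path of length \<open>m\<close> from \<open>p\<close> to \<open>q\<close>.
\<close>

definition k_protected :: "nat \<Rightarrow> plane_tree \<Rightarrow> nat list \<Rightarrow> bool" where
  "k_protected k t p \<longleftrightarrow>
     p \<in> vertices t \<and> (\<forall>m q. leaf t q \<longrightarrow> (p, q) \<in> child_rel t ^^ m \<longrightarrow> k \<le> m)"

definition protected_count :: "nat \<Rightarrow> nat \<Rightarrow> nat" where
  "protected_count k n = card {(t, p). card (vertices t) = n \<and> k_protected k t p}"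

end

theory Submission
  imports Defs "HOL-Computational_Algebra.Formal_Power_Series"
begin

text \<open>
  Let \<open>R\<^sub>k\<close> be the generating function of the trees whose root is \<open>k\<close>-protected, \<open>T = R\<^sub>0\<close>, and let
  \<open>B\<close> be that of the central binomial coefficients. Removing the root gives \<open>T (1 - T) = X\<close> and
  \<open>R\<^bsub>k+1\<^esub> = X R\<^sub>k / (1 - R\<^sub>k)\<close>; moreover the generating function \<open>M\<^sub>k\<close> of the counts satisfies
  \<open>M\<^sub>k = R\<^sub>k (1 - T) / (1 - 2 T) = R\<^sub>k (1 + B) / 2\<close>, since \<open>B = 1 / (1 - 2 T)\<close>. At the singularity
  \<open>1/4\<close> the recursion yields \<open>R\<^sub>k(1/4) = 3 / (2 (4\<^sup>k + 2))\<close>. Termwise, the convolution for \<open>M\<^sub>k\<close> divided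
  by the \<open>(n-1)\<close>-st central binomial coefficient tends to \<open>2 R\<^sub>k(1/4)\<close>. Limit and sum may be exchanged
  because the convolution is dominated by the one for \<open>k = 0\<close>, where \<open>M\<^sub>0 = X B\<close> makes the quotient exactly 1.
\<close>

unbundle fps_syntax

section \<open>Protected vertices of a tree and of its branches\<close>

lemma Nil_in_vertices [simp]: "[] \<in> vertices t"
  by (cases t) simp

lemma Cons_in_vertices [simp]:
  "i # p \<in> vertices (Node ts) \<longleftrightarrow> i < length ts \<and> p \<in> vertices (ts ! i)"
  by auto

declare vertices.simps [simp del]

lemma append_in_vertices: "p @ q \<in> vertices t \<Longrightarrow> p \<in> vertices t"
proof (induction p arbitrary: t)
  case (Cons i p)
  then show ?case by (cases t) auto
qed simp

lemma child_rel_iff: "(p, q) \<in> child_rel t \<longleftrightarrow> q \<in> vertices t \<and> (\<exists>i. q = p @ [i])"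
  by (auto simp: child_rel_def dest: append_in_vertices)

text \<open>Each step appends one index, so a path is determined by its end points. The vertices in
  between come for free because \<open>vertices t\<close> is closed under prefixes.\<close>

lemma child_rel_relpow_iff:
  assumes "p \<in> vertices t"
  shows "(p, q) \<in> child_rel t ^^ m \<longleftrightarrow> q \<in> vertices t \<and> (\<exists>r. length r = m \<and> q = p @ r)"
proof (induction m arbitrary: q)
  case 0
  then show ?case using assms by auto
next
  case (Suc m)
  have "(p, q) \<in> child_rel t ^^ Suc m \<longleftrightarrow>
      q \<in> vertices t \<and> (\<exists>r i. length r = m \<and> q = p @ r @ [i] \<and> p @ r \<in> vertices t)"
    by (auto simp: Suc child_rel_iff relcomp_unfold)
  also have "\<dots> \<longleftrightarrow> q \<in> vertices t \<and> (\<exists>r i. length r = m \<and> q = p @ r @ [i])"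
    by (metis append_in_vertices append_assoc)
  also have "\<dots> \<longleftrightarrow> q \<in> vertices t \<and> (\<exists>r. length r = Suc m \<and> q = p @ r)"
    by (metis length_append_singleton length_Suc_conv_rev)
  finally show ?case .
qed

lemma leaf_iff: "leaf t p \<longleftrightarrow> p \<in> vertices t \<and> (\<forall>i. p @ [i] \<notin> vertices t)"
  by (auto simp: leaf_def child_rel_iff)

lemma leaf_Nil [simp]: "leaf (Node ts) [] \<longleftrightarrow> ts = []"
  by (auto simp: leaf_iff)

lemma leaf_Cons [simp]: "leaf (Node ts) (i # p) \<longleftrightarrow> i < length ts \<and> leaf (ts ! i) p"
  by (auto simp: leaf_iff)

lemma k_protected_iff:
  "k_protected k t p \<longleftrightarrow> p \<in> vertices t \<and> (\<forall>r. leaf t (p @ r) \<longrightarrow> k \<le> length r)"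
  proof (cases "p \<in> vertices t")
  case True
  show ?thesis
    unfolding k_protected_def child_rel_relpow_iff [OF True] by (auto simp: leaf_def)
qed (simp add: k_protected_def)

text \<open>Protection only looks downwards, so the branch containing the vertex decides.\<close>

lemma k_protected_Cons:
  "k_protected k (Node ts) (i # p) \<longleftrightarrow> i < length ts \<and> k_protected k (ts ! i) p"
  by (auto simp: k_protected_iff)

lemma k_protected_0_Nil: "k_protected 0 t []"
  by (simp add: k_protected_iff)

text \<open>Seen from the root, every leaf of a branch lies one step deeper. The condition
  \<open>ts \<noteq> []\<close> excludes the root being a leaf itself, at distance 0.\<close>

lemma k_protected_Suc_Nil:
  "k_protected (Suc k) (Node ts) [] \<longleftrightarrow> ts \<noteq> [] \<and> (\<forall>t\<in>set ts. k_protected k t [])"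
proof -
  have split: "(\<forall>r. P r) \<longleftrightarrow> P [] \<and> (\<forall>i r. P (i # r))" for P :: "nat list \<Rightarrow> bool"
    by (metis list.exhaust)
  have "k_protected (Suc k) (Node ts) [] \<longleftrightarrow>
      ts \<noteq> [] \<and> (\<forall>i<length ts. \<forall>r. leaf (ts ! i) r \<longrightarrow> k \<le> length r)"
    by (simp add: k_protected_iff split [of "\<lambda>r. leaf (Node ts) r \<longrightarrow> Suc k \<le> length r"])
       blast
  then show ?thesis
    by (simp add: k_protected_iff all_set_conv_all_nth)
qed

section \<open>Counting vertices branch by branch\<close>

lemma finite_vertices: "finite (vertices t)"
  by (induction t rule: vertices.induct) (simp add: vertices.simps)

text \<open>The family \<open>V\<close> is left arbitrary to serve both for all vertices and for the
  protected ones.\<close>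

lemma card_indexed_branches:
  fixes V :: "plane_tree \<Rightarrow> nat list set"
  assumes fin: "\<And>t. finite (V t)"
  shows "card {i # p |i p. i < length ts \<and> p \<in> V (ts ! i)} = (\<Sum>t\<leftarrow>ts. card (V t))"
proof -
  have "{i # p |i p. i < length ts \<and> p \<in> V (ts ! i)} = (\<Union>i\<in>{..<length ts}. (#) i ` V (ts ! i))"
    by auto
  also have "card \<dots> = (\<Sum>i<length ts. card ((#) i ` V (ts ! i)))"
    by (rule card_UN_disjoint) (auto simp: fin)
  also have "\<dots> = (\<Sum>i<length ts. card (V (ts ! i)))"
    by (simp add: card_image)
  also have "\<dots> = (\<Sum>t\<leftarrow>ts. card (V t))"
    by (simp add: sum_list_sum_nth atLeast0LessThan)
  finally show ?thesis .
qed

definition nodes :: "plane_tree \<Rightarrow> nat" where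
  "nodes t = card (vertices t)"

definition protected_vertices :: "nat \<Rightarrow> plane_tree \<Rightarrow> nat list set" where
  "protected_vertices k t = {p. k_protected k t p}"

lemma finite_protected_vertices: "finite (protected_vertices k t)"
  by (rule finite_subset [OF _ finite_vertices [of t]])
     (auto simp: protected_vertices_def k_protected_iff)

lemma nodes_Node: "nodes (Node ts) = Suc (\<Sum>t\<leftarrow>ts. nodes t)"
proof -
  have "vertices (Node ts) = insert [] {i # p |i p. i < length ts \<and> p \<in> vertices (ts ! i)}"
    by (auto simp: vertices.simps)
  moreover have "finite {i # p |i p. i < length ts \<and> p \<in> vertices (ts ! i)}"
    by (rule finite_subset [OF _ finite_vertices [of "Node ts"]]) auto
  ultimately show ?thesis
    by (simp add: nodes_def card_indexed_branches finite_vertices)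
qed

lemma card_protected_vertices_Node:
  "card (protected_vertices k (Node ts)) =
     of_bool (k_protected k (Node ts) []) + (\<Sum>t\<leftarrow>ts. card (protected_vertices k t))"
proof -
  let ?C = "{i # p |i p. i < length ts \<and> p \<in> protected_vertices k (ts ! i)}"
  have "p \<in> protected_vertices k (Node ts) \<longleftrightarrow>
      p \<in> (if k_protected k (Node ts) [] then {[]} else {}) \<union> ?C" for p
    by (cases p) (auto simp: protected_vertices_def k_protected_Cons)
  then have eq: "protected_vertices k (Node ts) =
      (if k_protected k (Node ts) [] then {[]} else {}) \<union> ?C"
    by blast
  have "finite ?C"
    by (rule finite_subset [OF _ finite_protected_vertices [of k "Node ts"]]) (auto simp: eq)
  then show ?thesis
    unfolding eq by (simp add: card_indexed_branches finite_protected_vertices)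
qed

section \<open>Weighted generating functions of trees and forests\<close>

definition trees :: "nat \<Rightarrow> plane_tree set" where
  "trees n = {t. nodes t = n}"

definition forests :: "nat \<Rightarrow> plane_tree list set" where
  "forests n = {ts. (\<Sum>t\<leftarrow>ts. nodes t) = n}"

text \<open>Real weights allow the indicator of a protected root and the number of protected
  vertices to be treated alike.\<close>

definition tree_fps :: "(plane_tree \<Rightarrow> real) \<Rightarrow> real fps" where
  "tree_fps w = Abs_fps (\<lambda>n. \<Sum>t\<in>trees n. w t)"

definition forest_fps :: "(plane_tree list \<Rightarrow> real) \<Rightarrow> real fps" where
  "forest_fps w = Abs_fps (\<lambda>n. \<Sum>ts\<in>forests n. w ts)"

lemma trees_0 [simp]: "trees 0 = {}"
proof -
  have "nodes t \<noteq> 0" for t by (cases t) (simp add: nodes_Node)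
  then show ?thesis by (simp add: trees_def)
qed

lemma trees_Suc: "trees (Suc n) = Node ` forests n"
proof -
  have "t \<in> trees (Suc n) \<longleftrightarrow> t \<in> Node ` forests n" for t
    by (cases t) (auto simp: trees_def forests_def nodes_Node)
  then show ?thesis by blast
qed

lemma forests_eq:
  "forests n = (if n = 0 then {[]} else {}) \<union>
     (\<Union>i\<le>n. (\<lambda>(t, ts). t # ts) ` (trees i \<times> forests (n - i)))"
proof -
  have "ts \<in> forests n \<longleftrightarrow> ts \<in> (if n = 0 then {[]} else {}) \<union>
     (\<Union>i\<le>n. (\<lambda>(t, ts). t # ts) ` (trees i \<times> forests (n - i)))" for ts
  proof (cases ts)
    case (Cons t us)
    have "t # us \<in> forests n \<longleftrightarrow> nodes t \<le> n \<and> us \<in> forests (n - nodes t)"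
      by (auto simp: forests_def)
    then show ?thesis by (auto simp: Cons trees_def)
  qed (auto simp: forests_def)
  then show ?thesis by blast
qed

lemma finite_forests: "finite (forests n)"
proof (induction n rule: less_induct)
  case (less n)
  have trees: "finite (trees i)" if "i \<le> n" for i
    using that less by (cases i) (auto simp: trees_Suc)
  \<comment> \<open>For \<open>i = 0\<close> the induction hypothesis does not reach
    \<open>forests n\<close>, but the product is empty because \<open>trees 0\<close> is.\<close>
  have "finite (trees i \<times> forests (n - i))" if "i \<le> n" for i
    using that less trees by (cases i) auto
  then show ?case
    by (subst forests_eq) auto
qed

lemma finite_trees: "finite (trees n)"
  by (cases n) (simp_all add: trees_Suc finite_forests)

text \<open>Removing the root costs one vertex, hence the factor \<open>fps_X\<close>.\<close>

lemma tree_fps_eq: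
  assumes "\<And>ts. w (Node ts) = v ts"
  shows "tree_fps w = fps_X * forest_fps v"
proof (rule fps_ext)
  fix n
  show "tree_fps w $ n = (fps_X * forest_fps v) $ n"
  proof (cases n)
    case (Suc m)
    have "(\<Sum>t\<in>Node ` forests m. w t) = (\<Sum>ts\<in>forests m. v ts)"
      by (subst sum.reindex) (auto simp: assms inj_on_def)
    then show ?thesis by (simp add: Suc tree_fps_def forest_fps_def trees_Suc)
  qed (simp add: tree_fps_def)
qed

text \<open>Splitting off the first tree turns product weights into a convolution. The weight
  \<open>g\<close> of the tail may differ from \<open>f\<close>, which also covers additive weights:
  each summand is a product with one factor 1.\<close>

lemma forest_fps_eq:
  assumes "\<And>t ts. f (t # ts) = a t * g ts"
  shows "forest_fps f = fps_const (f []) + tree_fps a * forest_fps g"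
proof (rule fps_ext)
  fix n
  let ?U = "\<Union>i\<le>n. (\<lambda>(t, ts). t # ts) ` (trees i \<times> forests (n - i))"
  have "sum f ?U = (\<Sum>i\<le>n. sum f ((\<lambda>(t, ts). t # ts) ` (trees i \<times> forests (n - i))))"
    \<comment> \<open>The size of the first tree determines \<open>i\<close>, so the blocks are
      disjoint.\<close>
    by (rule sum.UNION_disjoint) (simp_all add: finite_trees finite_forests, auto simp: trees_def)
  also have "\<dots> = (\<Sum>i\<le>n. (\<Sum>t\<in>trees i. a t) * (\<Sum>ts\<in>forests (n - i). g ts))"
  proof (rule sum.cong)
    fix i
    have "sum f ((\<lambda>(t, ts). t # ts) ` (trees i \<times> forests (n - i))) =
        (\<Sum>(t, ts)\<in>trees i \<times> forests (n - i). a t * g ts)"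
      by (subst sum.reindex) (auto simp: inj_on_def assms intro!: sum.cong)
    then show "sum f ((\<lambda>(t, ts). t # ts) ` (trees i \<times> forests (n - i))) =
        (\<Sum>t\<in>trees i. a t) * (\<Sum>ts\<in>forests (n - i). g ts)"
      by (simp add: sum_product sum.cartesian_product)
  qed simp
  finally have U: "sum f ?U = (tree_fps a * forest_fps g) $ n"
    by (simp add: fps_mult_nth tree_fps_def forest_fps_def atLeast0AtMost)
  have "sum f (forests n) = sum f (if n = 0 then {[]} else {}) + sum f ?U"
    by (subst forests_eq, rule sum.union_disjoint) (auto simp: finite_trees finite_forests)
  then show "forest_fps f $ n = (fps_const (f []) + tree_fps a * forest_fps g) $ n"
    by (simp add: U forest_fps_def)
qed

lemma tree_fps_add: "tree_fps (\<lambda>t. v t + w t) = tree_fps v + tree_fps w"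
  by (rule fps_ext) (simp add: tree_fps_def sum.distrib)

lemma forest_fps_add: "forest_fps (\<lambda>ts. v ts + w ts) = forest_fps v + forest_fps w"
  by (rule fps_ext) (simp add: forest_fps_def sum.distrib)

lemma forest_fps_diff: "forest_fps (\<lambda>ts. v ts - w ts) = forest_fps v - forest_fps w"
  by (rule fps_ext) (simp add: forest_fps_def sum_subtractf)

section \<open>Functional equations for protected roots and marked vertices\<close>

definition root_fps :: "nat \<Rightarrow> real fps" where
  "root_fps k = tree_fps (\<lambda>t. of_bool (k_protected k t []))"

definition marked_fps :: "nat \<Rightarrow> real fps" where
  "marked_fps k = tree_fps (\<lambda>t. real (card (protected_vertices k t)))"

lemma protected_count_eq: "real (protected_count k n) = marked_fps k $ n"
proof -
  have "{(t, p). card (vertices t) = n \<and> k_protected k t p} = Sigma (trees n) (protected_vertices k)"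
    by (auto simp: trees_def nodes_def protected_vertices_def)
  then show ?thesis
    by (simp add: protected_count_def marked_fps_def tree_fps_def finite_trees
        finite_protected_vertices)
qed

lemma root_fps_0_eq: "root_fps 0 = tree_fps (\<lambda>_. 1)"
  by (simp add: root_fps_def k_protected_0_Nil)

lemma forest_fps_one: "(1 - root_fps 0) * forest_fps (\<lambda>_. 1) = 1"
proof -
  have "forest_fps (\<lambda>_. 1) = 1 + root_fps 0 * forest_fps (\<lambda>_. 1)"
    using forest_fps_eq [of "\<lambda>_. 1" "\<lambda>_. 1" "\<lambda>_. 1"] by (simp add: root_fps_0_eq)
  then show ?thesis by (simp add: algebra_simps)
qed

lemma root_fps_0_mult: "root_fps 0 * (1 - root_fps 0) = fps_X"
proof -
  have "root_fps 0 = fps_X * forest_fps (\<lambda>_. 1)"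
    unfolding root_fps_0_eq by (rule tree_fps_eq) simp
  then have "root_fps 0 * (1 - root_fps 0) = fps_X * ((1 - root_fps 0) * forest_fps (\<lambda>_. 1))"
    by (metis mult.assoc mult.commute)
  then show ?thesis by (simp add: forest_fps_one)
qed

text \<open>Below a \<open>Suc k\<close>-protected root hangs a nonempty sequence of trees with
  \<open>k\<close>-protected roots. With \<open>L\<close> counting all such sequences, the nonempty
  ones give \<open>L - 1\<close>.\<close>

lemma root_fps_Suc: "root_fps (Suc k) * (1 - root_fps k) = fps_X * root_fps k"
proof -
  define L where "L = forest_fps (\<lambda>ts. of_bool (\<forall>t\<in>set ts. k_protected k t []))"
  have L: "L = 1 + root_fps k * L"
    unfolding L_def root_fps_def by (subst forest_fps_eq) auto
  have E: "forest_fps (\<lambda>ts. of_bool (ts = [])) = 1"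
    using forest_fps_eq [of "\<lambda>ts. of_bool (ts = [])" "\<lambda>_. 0" "\<lambda>_. 0"]
    by (simp add: tree_fps_def fps_zero_def [symmetric])
  have "root_fps (Suc k) = fps_X *
      forest_fps (\<lambda>ts. of_bool (\<forall>t\<in>set ts. k_protected k t []) - of_bool (ts = []))"
    unfolding root_fps_def by (rule tree_fps_eq) (auto simp: k_protected_Suc_Nil)
  then have "root_fps (Suc k) = fps_X * (L - 1)"
    by (simp add: forest_fps_diff E L_def)
  then show ?thesis using L by algebra
qed

text \<open>The marked vertex is the root or lies in the forest below it, giving
  \<open>marked_fps k = root_fps k + fps_X * S\<close>. In the forest it lies in the first tree
  (\<open>A\<close>) or in a later one (\<open>C\<close>), giving a linear equation for
  \<open>S\<close>.\<close>

lemma marked_fps_mult: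
  "marked_fps k * (1 - 2 * root_fps 0) = root_fps k * (1 - root_fps 0)"
proof -
  define L where "L = forest_fps (\<lambda>_. 1)"
  define S where "S = forest_fps (\<lambda>ts. \<Sum>t\<leftarrow>ts. real (card (protected_vertices k t)))"
  define A where "A = forest_fps (\<lambda>ts. case ts of [] \<Rightarrow> 0 | t # us \<Rightarrow> real (card (protected_vertices k t)))"
  define C where "C = forest_fps (\<lambda>ts. case ts of [] \<Rightarrow> 0 | t # us \<Rightarrow> \<Sum>t\<leftarrow>us. real (card (protected_vertices k t)))"
  have "(\<lambda>ts. \<Sum>t\<leftarrow>ts. real (card (protected_vertices k t))) =
      (\<lambda>ts. (case ts of [] \<Rightarrow> 0 | t # us \<Rightarrow> real (card (protected_vertices k t))) +
        (case ts of [] \<Rightarrow> 0 | t # us \<Rightarrow> \<Sum>t\<leftarrow>us. real (card (protected_vertices k t))))"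
    by (auto split: list.split)
  then have "S = A + C"
    unfolding S_def A_def C_def by (simp add: forest_fps_add [symmetric])
  moreover have "A = marked_fps k * L"
    unfolding A_def L_def marked_fps_def by (subst forest_fps_eq) auto
  moreover have "C = root_fps 0 * S"
    unfolding C_def S_def root_fps_0_eq by (subst forest_fps_eq) auto
  ultimately have S: "S = marked_fps k * L + root_fps 0 * S" by simp
  have L: "(1 - root_fps 0) * L = 1"
    unfolding L_def by (rule forest_fps_one)
  have "real (\<Sum>t\<leftarrow>ts. card (protected_vertices k t)) = (\<Sum>t\<leftarrow>ts. real (card (protected_vertices k t)))" for ts
    by (induction ts) auto
  then have "tree_fps (\<lambda>t. real (card (protected_vertices k t)) - of_bool (k_protected k t [])) = fps_X * S"
    unfolding S_def by (intro tree_fps_eq) (simp add: card_protected_vertices_Node)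
  then have "marked_fps k = root_fps k + fps_X * S"
    using tree_fps_add [of "\<lambda>t. real (card (protected_vertices k t)) - of_bool (k_protected k t [])"
        "\<lambda>t. of_bool (k_protected k t [])"]
    by (simp add: marked_fps_def root_fps_def)
  moreover have "(1 - root_fps 0) * (fps_X * S) = fps_X * (marked_fps k * L)"
    using S by algebra
  moreover have "fps_X * L = root_fps 0"
    using L root_fps_0_mult by algebra
  ultimately show ?thesis by algebra
qed

section \<open>Central binomial coefficients\<close>

definition central_binomial_fps :: "real fps" where
  "central_binomial_fps = Abs_fps (\<lambda>n. real ((2 * n) choose n))"

text \<open>This recurrence yields both the differential equation of the generating function and the
  limit of consecutive quotients.\<close>

lemma central_binomial_Suc:
  "real (Suc n) * real ((2 * Suc n) choose Suc n) = real (4 * n + 2) * real ((2 * n) choose n)"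
proof -
  define F G where "F = (fact (2 * n) :: real)" and "G = (fact n :: real)"
  have "G > 0" by (simp add: G_def)
  have "real ((2 * Suc n) choose Suc n) = fact (2 * n + 2) / (fact (Suc n) * fact (Suc n))"
    by (subst binomial_fact) simp_all
  also have "\<dots> = (2 * real n + 2) * (2 * real n + 1) * F / ((real n + 1)\<^sup>2 * G\<^sup>2)"
    by (simp add: F_def G_def power2_eq_square algebra_simps)
  finally have "real ((2 * Suc n) choose Suc n) = \<dots>" .
  moreover have "real ((2 * n) choose n) = F / G\<^sup>2"
    unfolding F_def G_def by (subst binomial_fact) (simp_all add: power2_eq_square)
  moreover have "real (Suc n) * ((2 * real n + 2) * (2 * real n + 1) * F / ((real n + 1)\<^sup>2 * G\<^sup>2)) =
      real (4 * n + 2) * (F / G\<^sup>2)"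
  proof -
    have "real n + 1 \<noteq> 0" by linarith
    then show ?thesis
      using \<open>G > 0\<close> by (simp add: divide_simps) (simp add: algebra_simps power2_eq_square)
  qed
  ultimately show ?thesis by simp
qed

text \<open>The recurrence says \<open>B' (1 - 4 X) = 2 B\<close>. Hence
  \<open>B\<^sup>2 (1 - 4 X)\<close> has derivative zero and equals its constant term 1.\<close>

lemma central_binomial_fps_square: "central_binomial_fps\<^sup>2 * (1 - 4 * fps_X) = 1"
proof -
  let ?B = central_binomial_fps
  have deriv: "fps_deriv ?B * (1 - 4 * fps_X) = 2 * ?B"
  proof (rule fps_ext)
    fix n
    have "(fps_deriv ?B * (1 - 4 * fps_X)) $ n = fps_deriv ?B $ n - 4 * (fps_X * fps_deriv ?B) $ n"
      by (simp add: algebra_simps numeral_fps_const)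
    also have "\<dots> = (2 * ?B) $ n"
      using central_binomial_Suc [of n]
      by (cases n) (simp_all add: central_binomial_fps_def algebra_simps numeral_fps_const)
    finally show "(fps_deriv ?B * (1 - 4 * fps_X)) $ n = (2 * ?B) $ n" .
  qed
  have "fps_deriv (?B\<^sup>2 * (1 - 4 * fps_X)) =
      2 * ?B * (fps_deriv ?B * (1 - 4 * fps_X)) - 4 * ?B\<^sup>2"
    by (simp add: power2_eq_square algebra_simps numeral_fps_const)
  also have "\<dots> = 0"
    unfolding deriv by (simp add: power2_eq_square)
  finally have "?B\<^sup>2 * (1 - 4 * fps_X) = fps_const ((?B\<^sup>2 * (1 - 4 * fps_X)) $ 0)"
    by (simp only: fps_deriv_eq_0_iff)
  then show ?thesis
    by (simp add: central_binomial_fps_def power2_eq_square numeral_fps_const)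
qed

text \<open>Both factors have known squares, so the product is 1 or -1; the constant term fixes the
  sign.\<close>

lemma central_binomial_fps_mult: "central_binomial_fps * (1 - 2 * root_fps 0) = 1"
proof -
  let ?c = "central_binomial_fps * (1 - 2 * root_fps 0)"
  have "(1 - 2 * root_fps 0)\<^sup>2 = 1 - 4 * fps_X"
    unfolding root_fps_0_mult [symmetric] by (simp add: power2_eq_square algebra_simps)
  then have "?c\<^sup>2 = 1"
    using central_binomial_fps_square by (simp add: power_mult_distrib)
  then have "?c = 1 \<or> ?c = - 1"
    by (simp add: power2_eq_1_iff)
  moreover have "?c $ 0 = 1"
    by (simp add: central_binomial_fps_def root_fps_def tree_fps_def numeral_fps_const)
  moreover have "(- 1 :: real fps) $ 0 \<noteq> 1" by simp
  ultimately show ?thesis by metis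
qed

lemma marked_fps_eq: "marked_fps k = root_fps k * (fps_const (1 / 2) * (1 + central_binomial_fps))"
proof -
  let ?B = central_binomial_fps and ?T = "root_fps 0"
  have "2 * ((1 - ?T) * ?B) = 1 + ?B"
    using central_binomial_fps_mult by algebra
  moreover have "fps_const (1 / 2) * 2 = (1 :: real fps)"
    by (simp add: numeral_fps_const)
  ultimately have "(1 - ?T) * ?B = fps_const (1 / 2) * (1 + ?B)"
    by algebra
  moreover have "marked_fps k = root_fps k * ((1 - ?T) * ?B)"
    using marked_fps_mult [of k] central_binomial_fps_mult by algebra
  ultimately show ?thesis by simp
qed

text \<open>Every vertex is 0-protected, so this counts all vertices exactly; it supplies the
  dominating convolution.\<close>

lemma marked_fps_0: "marked_fps 0 = fps_X * central_binomial_fps"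
  using marked_fps_mult [of 0] central_binomial_fps_mult root_fps_0_mult by algebra

section \<open>Evaluation at the singularity\<close>

lemma root_fps_nonneg: "0 \<le> root_fps k $ n"
  by (simp add: root_fps_def tree_fps_def sum_nonneg)

lemma root_fps_le: "root_fps k $ n \<le> root_fps 0 $ n"
  unfolding root_fps_def tree_fps_def fps_nth_Abs_fps
  by (intro sum_mono) (simp add: k_protected_0_Nil)

lemma root_fps_nth_0 [simp]: "root_fps k $ 0 = 0"
  by (simp add: root_fps_def tree_fps_def)

text \<open>Nonnegative terms make both series absolutely convergent, as the Cauchy product
  requires.\<close>

lemma sums_fps_mult:
  fixes F G :: "real fps"
  assumes "\<And>n. 0 \<le> F $ n" "\<And>n. 0 \<le> G $ n" "0 \<le> x"
    and F: "(\<lambda>n. F $ n * x ^ n) sums a" and G: "(\<lambda>n. G $ n * x ^ n) sums b"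
  shows "(\<lambda>n. (F * G) $ n * x ^ n) sums (a * b)"
proof -
  have "(\<lambda>n. \<Sum>i\<le>n. (F $ i * x ^ i) * (G $ (n - i) * x ^ (n - i))) sums
      ((\<Sum>n. F $ n * x ^ n) * (\<Sum>n. G $ n * x ^ n))"
    by (rule Cauchy_product_sums) (use assms in \<open>auto simp: sums_iff abs_mult\<close>)
  moreover have "(\<Sum>i\<le>n. (F $ i * x ^ i) * (G $ (n - i) * x ^ (n - i))) = (F * G) $ n * x ^ n" for n
    by (auto simp: fps_mult_nth atLeast0AtMost sum_distrib_right power_add [symmetric]
        intro!: sum.cong)
  ultimately show ?thesis
    using F G by (simp add: sums_iff)
qed

lemma sums_fps_X: "(\<lambda>n. fps_X $ n * x ^ n) sums (x :: real)"
proof -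
  have "fps_X $ n * x ^ n = (if n = 1 then x ^ n else 0)" for n
    by (simp add: fps_X_def)
  then show ?thesis
    using sums_single [of 1 "\<lambda>n. x ^ n"] by simp
qed

text \<open>Convergence at the singularity is shown by induction: partial sums satisfy
  \<open>A (n + 1) \<le> 1/4 + (A n)\<^sup>2\<close>, and 1/2 is a fixed point of this
  bound.\<close>

lemma sums_root_fps_0: "(\<lambda>n. root_fps 0 $ n * (1 / 4) ^ n) sums (1 / 2)"
proof -
  let ?a = "\<lambda>n. root_fps 0 $ n * (1 / 4) ^ n :: real"
  have eq: "root_fps 0 = fps_X + root_fps 0 * root_fps 0"
    unfolding root_fps_0_mult [symmetric] by (simp add: algebra_simps)
  have "(\<Sum>i\<le>n. ?a i) \<le> 1 / 2" for n
  proof (induction n)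
    case (Suc n)
    have "(\<Sum>i\<le>Suc n. ?a i) =
        (\<Sum>i\<le>Suc n. fps_X $ i * (1 / 4) ^ i) + (\<Sum>i\<le>Suc n. (root_fps 0 * root_fps 0) $ i * (1 / 4) ^ i)"
      by (subst eq) (simp only: fps_add_nth distrib_right sum.distrib)
    also have "(\<Sum>i\<le>Suc n. fps_X $ i * (1 / 4) ^ i) = (1 / 4 :: real)"
      by (simp add: fps_X_def if_distrib [of "\<lambda>x. x * _"] cong: if_cong)
    also have "(\<Sum>i\<le>Suc n. (root_fps 0 * root_fps 0) $ i * (1 / 4) ^ i) \<le> (\<Sum>i\<le>n. ?a i) * (\<Sum>j\<le>n. ?a j)"
    proof -
      let ?D = "{(i, j). i + j \<le> Suc n}" and ?p = "\<lambda>(i, j). ?a i * ?a j"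
      have fin: "finite ?D"
        by (rule finite_subset [of _ "{..Suc n} \<times> {..Suc n}"]) auto
      have "(\<Sum>i\<le>Suc n. (root_fps 0 * root_fps 0) $ i * (1 / 4) ^ i) =
          (\<Sum>i\<le>Suc n. \<Sum>j\<le>i. ?a j * ?a (i - j))"
        by (intro sum.cong)
           (auto simp: fps_mult_nth atLeast0AtMost sum_distrib_right power_add [symmetric]
            intro!: sum.cong)
      also have "\<dots> = sum ?p ?D"
        by (rule sum.triangle_reindex_eq [symmetric])
      \<comment> \<open>An index above \<open>n\<close> must be \<open>Suc n\<close>, which forces
        the other one to be 0, where the coefficient vanishes.\<close>
      also have "\<dots> = sum ?p (?D \<inter> {..n} \<times> {..n})"
      proof (rule sum.mono_neutral_right [OF fin])
        show "\<forall>x\<in>?D - ?D \<inter> {..n} \<times> {..n}. ?p x = 0"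
        proof
          fix x assume "x \<in> ?D - ?D \<inter> {..n} \<times> {..n}"
          then have "fst x = 0 \<or> snd x = 0" by auto
          then show "?p x = 0" by (auto simp: case_prod_unfold)
        qed
      qed auto
      also have "\<dots> \<le> sum ?p ({..n} \<times> {..n})"
        by (rule sum_mono2) (auto simp: root_fps_nonneg)
      also have "\<dots> = (\<Sum>i\<le>n. ?a i) * (\<Sum>j\<le>n. ?a j)"
        by (simp add: sum_product sum.cartesian_product)
      finally show ?thesis .
    qed
    also have "(\<Sum>i\<le>n. ?a i) * (\<Sum>j\<le>n. ?a j) \<le> 1 / 2 * (1 / 2)"
      by (intro mult_mono Suc) (auto intro!: sum_nonneg simp: root_fps_nonneg)
    finally show ?case by simp
  qed simp
  then have "summable ?a"
    by (intro bounded_imp_summable [where B = "1 / 2"]) (simp_all add: root_fps_nonneg)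
  then obtain s where s: "?a sums s" by (auto simp: summable_def)
  have "?a sums (1 / 4 + s * s)"
    using sums_add [OF sums_fps_X [of "1 / 4"] sums_fps_mult [OF _ _ _ s s]]
    by (subst eq) (simp add: distrib_right root_fps_nonneg)
  with s have "s = 1 / 4 + s * s" by (rule sums_unique2)
  \<comment> \<open>The limit is a double root, so there is no second candidate to rule out.\<close>
  then have "(s - 1 / 2)\<^sup>2 = 0"
    by (simp add: power2_eq_square algebra_simps)
  then have "s = 1 / 2" by simp
  then show ?thesis using s by (simp only:)
qed

lemma sums_root_fps: "(\<lambda>n. root_fps k $ n * (1 / 4) ^ n) sums (3 / (2 * (4 ^ k + 2)))"
proof (induction k)
  case 0
  then show ?case using sums_root_fps_0 by simp
next
  case (Suc k)
  let ?a = "\<lambda>n. root_fps (Suc k) $ n * (1 / 4) ^ n" and ?s = "3 / (2 * (4 ^ k + 2)) :: real"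
  have "summable ?a"
    by (rule summable_comparison_test' [OF sums_summable [OF sums_root_fps_0]])
       (simp add: abs_mult root_fps_nonneg root_fps_le)
  then obtain s where s: "?a sums s" by (auto simp: summable_def)
  \<comment> \<open>Solved without subtraction, the recursion has only nonnegative coefficients, as
    \<open>sums_fps_mult\<close> demands.\<close>
  have eq: "root_fps (Suc k) = fps_X * root_fps k + root_fps (Suc k) * root_fps k"
    using root_fps_Suc [of k] by algebra
  have "?a sums (1 / 4 * ?s + s * ?s)"
    using sums_add [OF sums_fps_mult [OF _ _ _ sums_fps_X [of "1 / 4"] Suc.IH]
        sums_fps_mult [OF _ _ _ s Suc.IH]]
    by (subst eq) (simp add: distrib_right root_fps_nonneg)
  with s have "s = 1 / 4 * ?s + s * ?s" by (rule sums_unique2)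
  then have "4 * s = ?s + 4 * s * ?s" by linarith
  moreover have pos: "(4 :: real) ^ k > 0" by simp
  have "2 * ((4 :: real) ^ k + 2) > 0"
    using pos by (simp only: zero_less_mult_iff) linarith
  then have "2 * ((4 :: real) ^ k + 2) \<noteq> 0" by (rule less_imp_neq [symmetric])
  then have "?s * (2 * (4 ^ k + 2)) = 3"
    by (rule nonzero_eq_divide_eq [THEN iffD1]) simp
  \<comment> \<open>Multiplying by the denominator \<open>c\<close> of \<open>?s\<close> clears the
    fraction and leaves an equation linear in \<open>s\<close>.\<close>
  moreover have "4 * s * c = 3 + 12 * s" if "4 * s = u + 4 * s * u" "u * c = 3" for u c :: real
    using that by algebra
  ultimately have "4 * s * (2 * (4 ^ k + 2)) = 3 + 12 * s" by blast
  with pos have "s = 3 / (2 * (4 ^ Suc k + 2))"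
    by (simp add: eq_divide_eq add_pos_pos less_imp_neq [symmetric] algebra_simps)
  with s show ?case by simp
qed

section \<open>Transfer to the coefficients\<close>

text \<open>Pratt's generalisation of dominated convergence: the dominating terms may vary with \<open>n\<close>
  as long as no mass escapes from their sums.\<close>

lemma tendsto_sum_dominated:
  fixes f g :: "nat \<Rightarrow> nat \<Rightarrow> real"
  assumes nonneg: "\<And>n j. j \<le> n \<Longrightarrow> 0 \<le> f n j" and le: "\<And>n j. j \<le> n \<Longrightarrow> f n j \<le> g n j"
    and f: "\<And>j. (\<lambda>n. f n j) \<longlonglongrightarrow> F j" and g: "\<And>j. (\<lambda>n. g n j) \<longlonglongrightarrow> G j"
    and F: "F sums a" and G: "G sums b" and gb: "(\<lambda>n. \<Sum>j\<le>n. g n j) \<longlonglongrightarrow> b"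
  shows "(\<lambda>n. \<Sum>j\<le>n. f n j) \<longlonglongrightarrow> a"
proof (rule order_tendstoI)
  fix c assume "c < a"
  moreover have "(\<lambda>J. \<Sum>j<J. F j) \<longlonglongrightarrow> a"
    using F by (simp add: sums_def)
  ultimately obtain J where J: "c < (\<Sum>j<J. F j)"
    by (metis order_tendstoD(1) eventually_sequentially order_refl)
  have "(\<lambda>n. \<Sum>j<J. f n j) \<longlonglongrightarrow> (\<Sum>j<J. F j)"
    by (intro tendsto_sum f)
  then have "\<forall>\<^sub>F n in sequentially. c < (\<Sum>j<J. f n j)"
    using J by (rule order_tendstoD)
  then show "\<forall>\<^sub>F n in sequentially. c < (\<Sum>j\<le>n. f n j)"
    \<comment> \<open>For \<open>n \<ge> J\<close> the block \<open>j < J\<close> lies in the range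
      where \<open>nonneg\<close> applies.\<close>
    using eventually_ge_at_top [of J]
  proof eventually_elim
    case (elim n)
    have "(\<Sum>j<J. f n j) \<le> (\<Sum>j\<le>n. f n j)"
      by (rule sum_mono2) (use elim nonneg in auto)
    with elim show ?case by simp
  qed
next
  fix c assume "a < c"
  \<comment> \<open>For the upper bound, the sum of \<open>f\<close> is that of \<open>g\<close>
    minus that of the nonnegative gaps \<open>g - f\<close>. Keeping only the first \<open>J\<close>
    gaps overestimates it, with a limit that approaches \<open>a\<close> as \<open>J\<close>
    grows.\<close>
  have "(\<lambda>J. b - (\<Sum>j<J. G j - F j)) \<longlonglongrightarrow> b - (b - a)"
    using sums_diff [OF G F] unfolding sums_def by (intro tendsto_intros)
  with \<open>a < c\<close> obtain J where J: "b - (\<Sum>j<J. G j - F j) < c"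
    by (metis (no_types, lifting) order_tendstoD(2) eventually_sequentially order_refl diff_diff_eq2 add_diff_cancel_left')
  have "(\<lambda>n. (\<Sum>j\<le>n. g n j) - (\<Sum>j<J. g n j - f n j)) \<longlonglongrightarrow> b - (\<Sum>j<J. G j - F j)"
    by (intro tendsto_intros f g gb)
  then have "\<forall>\<^sub>F n in sequentially. (\<Sum>j\<le>n. g n j) - (\<Sum>j<J. g n j - f n j) < c"
    using J by (rule order_tendstoD)
  then show "\<forall>\<^sub>F n in sequentially. (\<Sum>j\<le>n. f n j) < c"
    using eventually_ge_at_top [of J]
  proof eventually_elim
    case (elim n)
    have "(\<Sum>j<J. g n j - f n j) \<le> (\<Sum>j\<le>n. g n j - f n j)"
      by (rule sum_mono2) (use elim le in auto)
    with elim show ?case by (simp add: sum_subtractf)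
  qed
qed

section \<open>Quotients of central binomial coefficients and the final limit\<close>

lemma central_binomial_fps_pos: "0 < central_binomial_fps $ n"
  by (simp add: central_binomial_fps_def)

text \<open>The quotient telescopes into \<open>i\<close> consecutive quotients, each tending to
  1/4.\<close>

lemma central_binomial_quotient_tendsto:
  "(\<lambda>n. central_binomial_fps $ n / central_binomial_fps $ (n + i)) \<longlonglongrightarrow> (1 / 4) ^ i"
proof (induction i)
  case 0
  then show ?case by (simp add: central_binomial_fps_def)
next
  case (Suc i)
  let ?b = "\<lambda>n. central_binomial_fps $ n"
  have "(\<lambda>n. real (Suc n) / real (4 * n + 2)) \<longlonglongrightarrow> 1 / 4"
  proof -
    have "(\<lambda>n. 1 / 4 + 1 / 4 * inverse (real (Suc (2 * n)))) \<longlonglongrightarrow> 1 / 4 + 1 / 4 * 0"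
      by (intro tendsto_intros LIMSEQ_subseq_LIMSEQ [OF LIMSEQ_inverse_real_of_nat, unfolded o_def])
         (simp add: strict_mono_def)
    moreover have "1 / 4 + 1 / 4 * inverse (real (Suc (2 * n))) = real (Suc n) / real (4 * n + 2)" for n
      by (simp add: divide_simps) (simp add: algebra_simps)
    ultimately show ?thesis by simp
  qed
  moreover have "real (Suc n) / real (4 * n + 2) = ?b n / ?b (Suc n)" for n
    using central_binomial_Suc [of n] central_binomial_fps_pos [of "Suc n"]
    by (simp add: central_binomial_fps_def divide_simps)
  ultimately have "(\<lambda>n. ?b n / ?b (Suc n)) \<longlonglongrightarrow> 1 / 4" by simp
  then have "(\<lambda>n. ?b (n + i) / ?b (Suc (n + i))) \<longlonglongrightarrow> 1 / 4"
    by (rule LIMSEQ_ignore_initial_segment)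
  from tendsto_mult [OF this Suc.IH] show ?case
    using central_binomial_fps_pos by (simp add: less_imp_neq [symmetric])
qed

theorem theorem3p3:
  fixes k :: nat
  shows "(\<lambda>n. real (protected_count k n)) \<sim>[sequentially]
         (\<lambda>n. 3 * real ((2 * n - 2) choose (n - 1)) / (4 ^ k + 2))"
proof -
  let ?b = "\<lambda>n. central_binomial_fps $ n"
  define P where "P = fps_const (1 / 2) * (1 + central_binomial_fps)"
  define f where "f k n j = root_fps k $ j * P $ (n - j) / ?b (n - 1)" for k n j
  have P_pos: "P $ n > 0" for n
    using central_binomial_fps_pos [of n] by (simp add: P_def add_nonneg_pos)
  have sum_f: "(\<Sum>j\<le>n. f k n j) = marked_fps k $ n / ?b (n - 1)" for k n
    by (simp add: f_def marked_fps_eq P_def [symmetric] fps_mult_nth atLeast0AtMost sum_divide_distrib)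
  \<comment> \<open>The factor 2 arises as 1/2 from \<open>P\<close> times 4 from the exponent
    \<open>j - 1\<close> in place of \<open>j\<close>. The term for \<open>j = 0\<close>
    vanishes.\<close>
  have f_lim: "(\<lambda>n. f k n j) \<longlonglongrightarrow> 2 * (root_fps k $ j * (1 / 4) ^ j)" for k j
  proof (cases j)
    case (Suc i)
    \<comment> \<open>The index is shifted by \<open>j\<close>. Positivity of \<open>n\<close>
      matters because \<open>P $ n\<close> is half the central binomial coefficient only for
      \<open>n > 0\<close>; \<open>P $ 0\<close> is 1.\<close>
    have "\<forall>\<^sub>F n in sequentially. root_fps k $ j / 2 * (?b n / ?b (n + i)) = f k (n + j) j"
      using eventually_gt_at_top [of 0]
      by eventually_elim (simp add: f_def P_def Suc)
    moreover have "(\<lambda>n. root_fps k $ j / 2 * (?b n / ?b (n + i))) \<longlonglongrightarrow> root_fps k $ j / 2 * (1 / 4) ^ i"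
      by (intro tendsto_intros central_binomial_quotient_tendsto)
    ultimately have "(\<lambda>n. f k (n + j) j) \<longlonglongrightarrow> root_fps k $ j / 2 * (1 / 4) ^ i"
      by (rule Lim_transform_eventually [rotated])
    then have "(\<lambda>n. f k n j) \<longlonglongrightarrow> root_fps k $ j / 2 * (1 / 4) ^ i"
      by (rule LIMSEQ_offset)
    then show ?thesis by (simp add: Suc)
  qed (simp add: f_def)
  have sums: "(\<lambda>j. 2 * (root_fps k $ j * (1 / 4) ^ j)) sums (3 / (4 ^ k + 2))" for k
  proof -
    have "2 * (3 / (2 * (4 ^ k + 2))) = (3 / (4 ^ k + 2) :: real)"
      unfolding times_divide_eq_right by (subst mult_divide_mult_cancel_left) simp_all
    then show ?thesis
      using sums_mult [OF sums_root_fps [of k], of 2] by (simp only:)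
  qed
  have "\<forall>\<^sub>F n in sequentially. (\<Sum>j\<le>n. f 0 n j) = 1"
    using eventually_gt_at_top [of 0]
  proof eventually_elim
    case (elim n)
    then show ?case
      using central_binomial_fps_pos [of "n - 1"] by (simp add: sum_f marked_fps_0)
  qed
  \<comment> \<open>The exact value 1 is the sum of the termwise limits for \<open>k = 0\<close>, so
    no mass escapes.\<close>
  then have f_0: "(\<lambda>n. \<Sum>j\<le>n. f 0 n j) \<longlonglongrightarrow> 3 / (4 ^ 0 + 2)"
    by (simp add: tendsto_eventually)
  have f_bounds: "0 \<le> f k n j" "f k n j \<le> f 0 n j" for n j
    using central_binomial_fps_pos [of "n - 1"] P_pos [of "n - j"]
    by (auto simp: f_def root_fps_nonneg root_fps_le intro!: divide_right_mono mult_right_mono)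
  have "(\<lambda>n. \<Sum>j\<le>n. f k n j) \<longlonglongrightarrow> 3 / (4 ^ k + 2)"
    by (rule tendsto_sum_dominated [where f = "f k" and g = "f 0",
          OF f_bounds f_lim f_lim sums sums f_0])
  then have lim: "(\<lambda>n. marked_fps k $ n / ?b (n - 1)) \<longlonglongrightarrow> 3 / (4 ^ k + 2)"
    by (simp only: sum_f)
  define c :: real where "c = 3 / (4 ^ k + 2)"
  have "c \<noteq> 0"
    by (simp add: c_def add_pos_pos less_imp_neq [symmetric])
  with lim have "(\<lambda>n. marked_fps k $ n / ?b (n - 1) / c) \<longlonglongrightarrow> c / c"
    unfolding c_def [symmetric] by (intro tendsto_divide tendsto_const)
  then have "(\<lambda>n. marked_fps k $ n / (c * ?b (n - 1))) \<longlonglongrightarrow> 1"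
    using \<open>c \<noteq> 0\<close> by (simp add: mult.commute)
  \<comment> \<open>With truncated subtraction \<open>2 * n - 2 = 2 * (n - 1)\<close> holds even at
    \<open>n = 0\<close>.\<close>
  moreover have "3 * real ((2 * n - 2) choose (n - 1)) / (4 ^ k + 2) = c * ?b (n - 1)" for n
    by (simp add: c_def central_binomial_fps_def right_diff_distrib')
  ultimately show ?thesis
    by (intro asymp_equivI') (simp only: protected_count_eq)
qed

end
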